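(* Let $T$ be a tournament with no transmitter and no receiver which is not strongly connected, with initial strong component $T_1$ and terminal strong component $T_m$. Then $T$ is quadrangular if and only if $T_{1}$ is in-quadrangular with $\delta^{-}(T_{1})\geq 2$ and $T_{m}$ is out-quadrangular with $\delta^{+}(T_{m})\geq 2$.
   Context: A tournament $T$ is a loopless digraph in which for each pair of distinct vertices exactly one of $(u,v)$, $(v,u)$ is an arc; $u\rightarrow v$ means $(u,v)$ is an arc. $O(v)=\{u:v\rightarrow u\}$, $I(v)=\{u:u\rightarrow v\}$. A digraph is quadrangular if for all distinct $u,v$, $|O(u)\cap O(v)|\neq 1$ and $|I(u)\cap I(v)|\neq 1$; out-quadrangular if only the first condition is required, in-quadrangular if only the second. A transmitter dominates all other vertices; a receiver is dominated by all other vertices. If $T$ is not strongly connected, its strong components (induced subtournaments) can be labeled $T_1,\dots,T_m$ so that every vertex of $T_i$ beats every vertex of $T_j$ whenever $i<j$; $T_1$ is the initial and $T_m$ the terminal strong component. $\delta^{+}$ and $\delta^{-}$ denote minimum out-degree and minimum in-degree (computed within the subtournament). *)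

theory Defs
  imports "Graph_Theory.Graph_Theory"
begin

(* Locale digraph already provides finiteness and the absence of loops and of parallel arcs,
   so arcs are determined by their ends.  The library admits the null graph; it is excluded
   here, since it has no strong components. *)
locale tournament = digraph +
  assumes verts_nonempty: "verts G \<noteq> {}"
    and exactly_one_arc:
      "\<And>u v. \<lbrakk>u \<in> verts G; v \<in> verts G; u \<noteq> v\<rbrakk> \<Longrightarrow> (u \<rightarrow>\<^bsub>G\<^esub> v) \<noteq> (v \<rightarrow>\<^bsub>G\<^esub> u)"

definition out_set :: "('a,'b) pre_digraph \<Rightarrow> 'a \<Rightarrow> 'a set" where
  "out_set G v = {u \<in> verts G. v \<rightarrow>\<^bsub>G\<^esub> u}"

definition in_set :: "('a,'b) pre_digraph \<Rightarrow> 'a \<Rightarrow> 'a set" where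
  "in_set G v = {u \<in> verts G. u \<rightarrow>\<^bsub>G\<^esub> v}"

definition out_quadrangular :: "('a,'b) pre_digraph \<Rightarrow> bool" where
  "out_quadrangular G \<longleftrightarrow>
     (\<forall>u \<in> verts G. \<forall>v \<in> verts G. u \<noteq> v \<longrightarrow> card (out_set G u \<inter> out_set G v) \<noteq> 1)"

definition in_quadrangular :: "('a,'b) pre_digraph \<Rightarrow> bool" where
  "in_quadrangular G \<longleftrightarrow>
     (\<forall>u \<in> verts G. \<forall>v \<in> verts G. u \<noteq> v \<longrightarrow> card (in_set G u \<inter> in_set G v) \<noteq> 1)"

definition quadrangular :: "('a,'b) pre_digraph \<Rightarrow> bool" where
  "quadrangular G \<longleftrightarrow>
     (\<forall>u \<in> verts G. \<forall>v \<in> verts G. u \<noteq> v \<longrightarrow>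
        card (out_set G u \<inter> out_set G v) \<noteq> 1 \<and> card (in_set G u \<inter> in_set G v) \<noteq> 1)"

definition transmitter :: "('a,'b) pre_digraph \<Rightarrow> 'a \<Rightarrow> bool" where
  "transmitter G v \<longleftrightarrow> v \<in> verts G \<and> (\<forall>u \<in> verts G. u \<noteq> v \<longrightarrow> v \<rightarrow>\<^bsub>G\<^esub> u)"

definition receiver :: "('a,'b) pre_digraph \<Rightarrow> 'a \<Rightarrow> bool" where
  "receiver G v \<longleftrightarrow> v \<in> verts G \<and> (\<forall>u \<in> verts G. u \<noteq> v \<longrightarrow> u \<rightarrow>\<^bsub>G\<^esub> v)"

definition min_out_degree :: "('a,'b) pre_digraph \<Rightarrow> nat" where
  "min_out_degree G = Min (out_degree G ` verts G)"

definition min_in_degree :: "('a,'b) pre_digraph \<Rightarrow> nat" where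
  "min_in_degree G = Min (in_degree G ` verts G)"

(* Ts lists the strong components (as induced subgraphs), each exactly once, so that earlier
   components beat later ones; hd Ts is the initial and last Ts the terminal component. *)
definition scc_labelling ::
  "('a,'b) pre_digraph \<Rightarrow> ('a,'b) pre_digraph list \<Rightarrow> bool" where
  "scc_labelling G Ts \<longleftrightarrow> distinct Ts \<and> set Ts = pre_digraph.sccs G \<and>
     (\<forall>i j. i < j \<and> j < length Ts \<longrightarrow>
        (\<forall>u \<in> verts (Ts ! i). \<forall>v \<in> verts (Ts ! j). u \<rightarrow>\<^bsub>G\<^esub> v))"

(* Every tournament has such a labelling: sort the components by the number of vertices
   from which they can be reached. *)
lemma (in tournament) scc_labelling_exists: "\<exists>Ts. scc_labelling G Ts \<and> Ts \<noteq> []"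
proof -
  define f where "f H = card {w. \<exists>u \<in> verts H. w \<rightarrow>\<^sup>*\<^bsub>G\<^esub> u}"
    for H :: "('a,'b) pre_digraph"
  have sv: "sccs = induce_subgraph G ` sccs_verts" by (rule sccs_conv_sccs_verts)
  have sub: "S \<subseteq> verts G" if "S \<in> sccs_verts" for S
    using that by (auto simp: sccs_verts_def dest: reachable_in_verts)
  have "sccs_verts \<subseteq> Pow (verts G)" using sub by auto
  then have fin: "finite sccs"
    unfolding sv by (meson finite_Pow_iff finite_imageI finite_subset finite_verts)
  have less: "f D < f C"
    if C: "C \<in> sccs" and D: "D \<in> sccs" and ne: "C \<noteq> D"
      and v: "v \<in> verts D" and u: "u \<in> verts C" and vu: "v \<rightarrow>\<^bsub>G\<^esub> u" for C D u v
  proof -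
    obtain S where S: "S \<in> sccs_verts" "C = G \<restriction> S" using C sv by auto
    obtain R where R: "R \<in> sccs_verts" "D = G \<restriction> R" using D sv by auto
    have SR: "S \<inter> R = {}" using S R ne by (intro sccs_verts_disjoint) auto
    have uS: "u \<in> S" and vR: "v \<in> R" using u v S R by auto
    have Rr: "x \<rightarrow>\<^sup>* y" if "x \<in> R" "y \<in> R" for x y
      using R(1) that by (auto simp: sccs_verts_def)
    have Sr: "x \<rightarrow>\<^sup>* y" if "x \<in> S" "y \<in> S" for x y
      using S(1) that by (auto simp: sccs_verts_def)
    have vur: "v \<rightarrow>\<^sup>* u" using vu by simp
    have no: "\<not> u \<rightarrow>\<^sup>* y" if "y \<in> R" for y
    proof
      assume "u \<rightarrow>\<^sup>* y"
      then have "u \<rightarrow>\<^sup>* v" using Rr[OF that vR] by (rule reachable_trans)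
      moreover have "u \<notin> R" using SR uS by auto
      ultimately show False using R(1) vR vur by (auto simp: sccs_verts_def)
    qed
    let ?A = "{w. \<exists>u \<in> R. w \<rightarrow>\<^sup>*\<^bsub>G\<^esub> u}" and ?B = "{w. \<exists>u \<in> S. w \<rightarrow>\<^sup>*\<^bsub>G\<^esub> u}"
    have "?A \<subseteq> ?B"
    proof
      fix w assume "w \<in> ?A"
      then obtain y where y: "y \<in> R" "w \<rightarrow>\<^sup>* y" by auto
      have "w \<rightarrow>\<^sup>* v" using y(2) Rr[OF y(1) vR] by (rule reachable_trans)
      then have "w \<rightarrow>\<^sup>* u" using vur by (rule reachable_trans)
      then show "w \<in> ?B" using uS by auto
    qed
    moreover have "u \<in> ?B" using Sr uS by auto
    moreover have "u \<notin> ?A" using no by auto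
    ultimately have "?A \<subset> ?B" by blast
    moreover have "finite ?B"
      by (rule finite_subset[OF _ finite_verts]) (auto dest: reachable_in_verts)
    ultimately have "card ?A < card ?B" by (rule psubset_card_mono[rotated])
    then show ?thesis by (simp add: f_def S R)
  qed
  obtain L where L: "set L = sccs" "distinct L" using finite_distinct_list[OF fin] by blast
  define Ts where "Ts = sort_key f L"
  have Ts: "set Ts = sccs" "distinct Ts" "sorted (map f Ts)" using L by (auto simp: Ts_def)
  have "u \<rightarrow>\<^bsub>G\<^esub> v"
    if ij: "i < j" "j < length Ts" and u: "u \<in> verts (Ts ! i)" and v: "v \<in> verts (Ts ! j)"
    for i j u v
  proof -
    have C: "Ts ! i \<in> sccs" and D: "Ts ! j \<in> sccs" using Ts(1) ij nth_mem[of i Ts] nth_mem[of j Ts] by simp_all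
    have ne: "Ts ! i \<noteq> Ts ! j" using ij Ts(2) by (simp add: nth_eq_iff_index_eq)
    have le: "f (Ts ! i) \<le> f (Ts ! j)"
      using Ts(3) ij sorted_nth_mono[of "map f Ts" i j] by simp
    obtain S where S: "S \<in> sccs_verts" "Ts ! i = G \<restriction> S" using C sv by auto
    obtain R where R: "R \<in> sccs_verts" "Ts ! j = G \<restriction> R" using D sv by auto
    have "S \<inter> R = {}" using S R ne by (intro sccs_verts_disjoint) auto
    then have uv: "u \<noteq> v" using u v S R by auto
    have "u \<in> verts G" "v \<in> verts G" using u v S R sub by auto
    then have "(u \<rightarrow>\<^bsub>G\<^esub> v) \<noteq> (v \<rightarrow>\<^bsub>G\<^esub> u)" using uv by (rule exactly_one_arc)
    moreover have "\<not> v \<rightarrow>\<^bsub>G\<^esub> u" using less[OF C D ne v u] le by auto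
    ultimately show ?thesis by blast
  qed
  then have "scc_labelling G Ts" unfolding scc_labelling_def using Ts by blast
  moreover obtain x where x: "x \<in> verts G" using verts_nonempty by auto
  have "scc_of x \<in> sccs_verts"
    using x by (simp add: scc_of_in_sccs_verts)
  then have "Ts \<noteq> []" using Ts(1) sv by auto
  ultimately show ?thesis by blast
qed

end

theory Submission
  imports Defs
begin

text \<open>
  In-neighbourhoods of vertices of \<open>T\<^sub>1\<close> stay inside \<open>T\<^sub>1\<close>, while every other vertex has all of
  \<open>T\<^sub>1\<close> as in-neighbours. So two vertices of \<open>T\<^sub>1\<close> have the same common in-neighbours in \<open>T\<close> as in
  \<open>T\<^sub>1\<close>; a vertex \<open>u\<close> of \<open>T\<^sub>1\<close> and one outside have precisely \<open>I(u)\<close> in common, which is nonempty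
  since \<open>u\<close> is no transmitter; and two vertices outside share all of \<open>T\<^sub>1\<close>. Out-neighbourhoods and
  \<open>T\<^sub>m\<close> behave in the same way, so both halves are instances of one statement on set families.
\<close>

lemma card_Int_neighbourhoods_iff:
  fixes N :: "'a \<Rightarrow> 'a set"
  assumes fin: "finite V" and NV: "\<And>v. v \<in> V \<Longrightarrow> N v \<subseteq> V"
    and A: "A \<noteq> {}" "A \<subset> V"
    and inside: "\<And>v. v \<in> A \<Longrightarrow> N v \<subseteq> A" and ne: "\<And>v. v \<in> A \<Longrightarrow> N v \<noteq> {}"
    and outside: "\<And>v. v \<in> V - A \<Longrightarrow> A \<subseteq> N v"
  shows "(\<forall>u\<in>V. \<forall>v\<in>V. u \<noteq> v \<longrightarrow> card (N u \<inter> N v) \<noteq> 1) \<longleftrightarrow>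
         (\<forall>u\<in>A. \<forall>v\<in>A. u \<noteq> v \<longrightarrow> card (N u \<inter> N v) \<noteq> 1) \<and> (\<forall>v\<in>A. 2 \<le> card (N v))"
    (is "?L \<longleftrightarrow> ?R")
proof
  have finN: "finite (N v)" if "v \<in> V" for v
    using NV[OF that] fin finite_subset by blast
  have mixed: "N u \<inter> N v = N u" if "u \<in> A" "v \<in> V - A" for u v
    using inside outside that by blast
  show ?R if L: ?L
  proof -
    \<comment> \<open>Pairing \<open>v\<close> with an outside \<open>w\<close> turns the condition
      on common neighbours into one on \<open>card (N v)\<close> alone: it is not 1, and it is not 0
      by \<open>ne\<close>.\<close>
    obtain w where w: "w \<in> V - A" using A by blast
    have "2 \<le> card (N v)" if v: "v \<in> A" for v
    proof -
      have "v \<in> V" "w \<in> V" "v \<noteq> w" using v w A by auto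
      then have "card (N v \<inter> N w) \<noteq> 1" using L by blast
      moreover have "card (N v) \<noteq> 0" using ne[OF v] finN[OF \<open>v \<in> V\<close>] by simp
      ultimately show ?thesis using mixed[OF v w] by simp
    qed
    moreover have "\<forall>u\<in>A. \<forall>v\<in>A. u \<noteq> v \<longrightarrow> card (N u \<inter> N v) \<noteq> 1"
      using L A(2) by blast
    ultimately show ?R by blast
  qed
  show ?L if R: ?R
  proof (intro ballI impI)
    fix u v assume uv: "u \<in> V" "v \<in> V" "u \<noteq> v"
    consider "u \<in> A" "v \<in> A" | "u \<in> A" "v \<in> V - A" | "u \<in> V - A" "v \<in> A"
      | "u \<in> V - A" "v \<in> V - A" using uv by blast
    then show "card (N u \<inter> N v) \<noteq> 1"
    proof cases
      case 1
      then show ?thesis using R uv(3) by blast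
    next
      case 2
      then have "2 \<le> card (N u \<inter> N v)" using R mixed by simp
      then show ?thesis by simp
    next
      case 3
      then have "2 \<le> card (N u \<inter> N v)" using R mixed[of v u] by (simp add: Int_commute)
      then show ?thesis by simp
    next
      case 4
      \<comment> \<open>Both neighbourhoods contain all of \<open>A\<close>. That \<open>A\<close>
        has at least two elements follows from any \<open>a\<close> in it, since \<open>N a\<close>
        lies in \<open>A\<close> and has at least two.\<close>
      obtain a where a: "a \<in> A" using A(1) by blast
      have "N a \<subseteq> N u \<inter> N v" using inside[OF a] outside 4 by blast
      then have "card (N a) \<le> card (N u \<inter> N v)" using finN uv(1) by (intro card_mono) auto
      then show ?thesis using R a by fastforce
    qed
  qed
qed

context digraph
begin

text \<open>Degrees count arcs, neighbourhoods count vertices. Without parallel arcs,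
  \<open>tail\<close> is injective on the arcs entering \<open>v\<close>, so the counts
  agree.\<close>

lemma in_degree_eq_card_in_set: "in_degree G v = card (in_set G v)"
proof -
  have "inj_on (tail G) (in_arcs G v)"
    by (auto intro!: inj_onI no_multi_arcs simp: arc_to_ends_def)
  moreover have "tail G ` in_arcs G v = in_set G v"
    by (force simp: in_set_def arcs_ends_def arc_to_ends_def)
  ultimately show ?thesis unfolding in_degree_def by (metis card_image)
qed

lemma out_degree_eq_card_out_set: "out_degree G v = card (out_set G v)"
proof -
  have "inj_on (head G) (out_arcs G v)"
    by (auto intro!: inj_onI no_multi_arcs simp: arc_to_ends_def)
  moreover have "head G ` out_arcs G v = out_set G v"
    by (force simp: out_set_def arcs_ends_def arc_to_ends_def)
  ultimately show ?thesis unfolding out_degree_def by (metis card_image)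
qed

lemma le_min_in_degree_iff:
  "verts G \<noteq> {} \<Longrightarrow> k \<le> min_in_degree G \<longleftrightarrow> (\<forall>v\<in>verts G. k \<le> card (in_set G v))"
  by (simp add: min_in_degree_def in_degree_eq_card_in_set)

lemma le_min_out_degree_iff:
  "verts G \<noteq> {} \<Longrightarrow> k \<le> min_out_degree G \<longleftrightarrow> (\<forall>v\<in>verts G. k \<le> card (out_set G v))"
  by (simp add: min_out_degree_def out_degree_eq_card_out_set)

end

lemma in_set_induce_subgraph:
  "A \<subseteq> verts G \<Longrightarrow> v \<in> A \<Longrightarrow> in_set (G \<restriction> A) v = in_set G v \<inter> A"
  by (force simp: in_set_def arcs_ends_def arc_to_ends_def)

lemma out_set_induce_subgraph:
  "A \<subseteq> verts G \<Longrightarrow> v \<in> A \<Longrightarrow> out_set (G \<restriction> A) v = out_set G v \<inter> A"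
  by (force simp: out_set_def arcs_ends_def arc_to_ends_def)

context tournament
begin

lemma not_dominates_flip: "u \<rightarrow> v \<Longrightarrow> \<not> v \<rightarrow> u"
  by (metis exactly_one_arc adj_in_verts adj_not_same)

text \<open>The set-family equivalence with \<open>N = in_set G\<close>. As \<open>A\<close> beats
  everything outside it, no arc enters \<open>A\<close>, so in-neighbourhoods of vertices of
  \<open>A\<close> are the same in \<open>G\<close> and in the subtournament on
  \<open>A\<close>.\<close>

lemma in_quadrangular_iff_dominating_subset:
  assumes nt: "\<nexists>v. transmitter G v" and A: "A \<noteq> {}" "A \<subset> verts G"
    and dom: "\<And>a v. a \<in> A \<Longrightarrow> v \<in> verts G - A \<Longrightarrow> a \<rightarrow> v"
  shows "in_quadrangular G \<longleftrightarrow> in_quadrangular (G \<restriction> A) \<and> 2 \<le> min_in_degree (G \<restriction> A)"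
proof -
  have sub: "A \<subseteq> verts G" using A by blast
  interpret H: digraph "G \<restriction> A" using sub by (intro digraphI_induced induced_induce)
  have inside: "in_set G v \<subseteq> A" if "v \<in> A" for v
    using dom[OF that] not_dominates_flip by (auto simp: in_set_def)
  \<comment> \<open>Since \<open>v\<close> is no transmitter, it fails to beat some other vertex,
    which therefore beats \<open>v\<close>.\<close>
  have nonempty: "in_set G v \<noteq> {}" if "v \<in> A" for v
    using nt exactly_one_arc sub that unfolding transmitter_def in_set_def by blast
  have eq: "in_set (G \<restriction> A) v = in_set G v" if "v \<in> A" for v
    using in_set_induce_subgraph[OF sub that] inside[OF that] by blast
  have "in_quadrangular G \<longleftrightarrow>
      (\<forall>u\<in>A. \<forall>v\<in>A. u \<noteq> v \<longrightarrow> card (in_set G u \<inter> in_set G v) \<noteq> 1) \<and> (\<forall>v\<in>A. 2 \<le> card (in_set G v))"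
    unfolding in_quadrangular_def
    by (rule card_Int_neighbourhoods_iff)
      (use A dom inside nonempty in \<open>auto simp: in_set_def\<close>)
  then show ?thesis
    using A(1) by (simp add: H.le_min_in_degree_iff in_quadrangular_def[of "G \<restriction> A"] eq)
qed

text \<open>The same argument with all arcs reversed: no arc leaves \<open>A\<close>, and the
  absence of receivers makes out-neighbourhoods nonempty.\<close>

lemma out_quadrangular_iff_dominated_subset:
  assumes nr: "\<nexists>v. receiver G v" and A: "A \<noteq> {}" "A \<subset> verts G"
    and dom: "\<And>a v. a \<in> A \<Longrightarrow> v \<in> verts G - A \<Longrightarrow> v \<rightarrow> a"
  shows "out_quadrangular G \<longleftrightarrow> out_quadrangular (G \<restriction> A) \<and> 2 \<le> min_out_degree (G \<restriction> A)"
proof -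
  have sub: "A \<subseteq> verts G" using A by blast
  interpret H: digraph "G \<restriction> A" using sub by (intro digraphI_induced induced_induce)
  have inside: "out_set G v \<subseteq> A" if "v \<in> A" for v
    using dom[OF that] not_dominates_flip by (auto simp: out_set_def)
  have nonempty: "out_set G v \<noteq> {}" if "v \<in> A" for v
    using nr exactly_one_arc sub that unfolding receiver_def out_set_def by blast
  have eq: "out_set (G \<restriction> A) v = out_set G v" if "v \<in> A" for v
    using out_set_induce_subgraph[OF sub that] inside[OF that] by blast
  have "out_quadrangular G \<longleftrightarrow>
      (\<forall>u\<in>A. \<forall>v\<in>A. u \<noteq> v \<longrightarrow> card (out_set G u \<inter> out_set G v) \<noteq> 1) \<and> (\<forall>v\<in>A. 2 \<le> card (out_set G v))"
    unfolding out_quadrangular_def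
    by (rule card_Int_neighbourhoods_iff)
      (use A dom inside nonempty in \<open>auto simp: out_set_def\<close>)
  then show ?thesis
    using A(1) by (simp add: H.le_min_out_degree_iff out_quadrangular_def[of "G \<restriction> A"] eq)
qed

text \<open>Allows a strong component to play the role of \<open>A\<close> in the two equivalences.
  It is a proper part because walks in \<open>C\<close> are walks in \<open>G\<close>, so a
  component on all vertices would make \<open>G\<close> strongly connected.\<close>

lemma scc_proper_induced:
  assumes "\<not> strongly_connected G" and C: "C \<in> sccs"
  shows "C = G \<restriction> verts C" "verts C \<noteq> {}" "verts C \<subset> verts G"
proof -
  have ind: "induced_subgraph C G" and sc: "strongly_connected C"
    using C by (auto simp: sccs_def)
  show eq: "C = G \<restriction> verts C" using ind by (simp add: induce_eq_iff_induced)
  show "verts C \<noteq> {}" using sc by (simp add: strongly_connected_def)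
  have "verts C \<subseteq> verts G" using ind by (auto simp: induced_subgraph_def)
  moreover have "verts C \<noteq> verts G"
  proof
    assume "verts C = verts G"
    then have "u \<rightarrow>\<^sup>*\<^bsub>G\<^esub> v" if "u \<in> verts G" "v \<in> verts G" for u v
      using that sc reachable_mono[OF _ induced_imp_subgraph[OF ind]]
      by (simp add: strongly_connected_def)
    then show False using assms(1) verts_nonempty by (auto simp: strongly_connected_def)
  qed
  ultimately show "verts C \<subset> verts G" by blast
qed

text \<open>The subgraph induced on \<open>scc_of v\<close> is a strong component containing
  \<open>v\<close>, so it occurs in the list.\<close>

lemma scc_labelling_vertexE:
  assumes "scc_labelling G Ts" "v \<in> verts G"
  obtains i where "i < length Ts" "v \<in> verts (Ts ! i)"
proof -
  have "G \<restriction> scc_of v \<in> set Ts"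
    using assms by (simp add: scc_labelling_def sccs_conv_sccs_verts scc_of_in_sccs_verts)
  then obtain i where "i < length Ts" "Ts ! i = G \<restriction> scc_of v" by (auto simp: in_set_conv_nth)
  then show thesis using that in_scc_of_self[OF assms(2)] by simp
qed

end

theorem theorem4:
  fixes T :: "('a,'b) pre_digraph" and Ts :: "('a,'b) pre_digraph list"
  assumes "tournament T"
    and "\<nexists>v. transmitter T v"
    and "\<nexists>v. receiver T v"
    and "\<not> strongly_connected T"
    and "scc_labelling T Ts"
  shows "quadrangular T \<longleftrightarrow>
           in_quadrangular (hd Ts) \<and> min_in_degree (hd Ts) \<ge> 2 \<and>
           out_quadrangular (last Ts) \<and> min_out_degree (last Ts) \<ge> 2"
proof -
  interpret tournament T by fact
  note labelE = scc_labelling_vertexE[OF assms(5)]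
  have beats: "u \<rightarrow>\<^bsub>T\<^esub> v"
    if "i < j" "j < length Ts" "u \<in> verts (Ts ! i)" "v \<in> verts (Ts ! j)" for i j u v
    using assms(5) that unfolding scc_labelling_def by blast
  obtain x where "x \<in> verts T" using verts_nonempty by blast
  then have "Ts \<noteq> []" using labelE by (metis list.size(3) not_less_zero)
  then have "hd Ts \<in> sccs" "last Ts \<in> sccs" using assms(5) by (auto simp: scc_labelling_def)
  note hd = scc_proper_induced[OF assms(4) this(1)] and last = scc_proper_induced[OF assms(4) this(2)]
  have "in_quadrangular T \<longleftrightarrow> in_quadrangular (hd Ts) \<and> 2 \<le> min_in_degree (hd Ts)"
  \<comment> \<open>Folding with \<open>hd(1)\<close> turns the subgraph induced on
    \<open>verts (hd Ts)\<close> back into \<open>hd Ts\<close>.\<close>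
  proof (rule in_quadrangular_iff_dominating_subset[OF assms(2) hd(2,3), folded hd(1)])
    fix a v assume a: "a \<in> verts (hd Ts)" and v: "v \<in> verts T - verts (hd Ts)"
    then obtain i where i: "i < length Ts" "v \<in> verts (Ts ! i)" using labelE by blast
    \<comment> \<open>Index 0 belongs to \<open>hd Ts\<close>, which misses \<open>v\<close>; hence
      \<open>0 < i\<close> and the ordering of the components applies.\<close>
    have "i \<noteq> 0" using i v \<open>Ts \<noteq> []\<close> by (metis DiffD2 hd_conv_nth)
    then show "a \<rightarrow>\<^bsub>T\<^esub> v" using beats[of 0 i] i a \<open>Ts \<noteq> []\<close> by (simp add: hd_conv_nth)
  qed
  moreover have "out_quadrangular T \<longleftrightarrow> out_quadrangular (last Ts) \<and> 2 \<le> min_out_degree (last Ts)"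
  proof (rule out_quadrangular_iff_dominated_subset[OF assms(3) last(2,3), folded last(1)])
    fix a v assume a: "a \<in> verts (last Ts)" and v: "v \<in> verts T - verts (last Ts)"
    then obtain i where i: "i < length Ts" "v \<in> verts (Ts ! i)" using labelE by blast
    \<comment> \<open>Now \<open>i\<close> lies strictly below the index of \<open>last Ts\<close>,
      which is a valid index because \<open>Ts\<close> is nonempty.\<close>
    have "i \<noteq> length Ts - 1" using i v \<open>Ts \<noteq> []\<close> by (metis DiffD2 last_conv_nth)
    then show "v \<rightarrow>\<^bsub>T\<^esub> a"
      using beats[of i "length Ts - 1"] i a \<open>Ts \<noteq> []\<close> by (simp add: last_conv_nth)
  qed
  moreover have "quadrangular T \<longleftrightarrow> in_quadrangular T \<and> out_quadrangular T"
    unfolding quadrangular_def in_quadrangular_def out_quadrangular_def by blast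
  ultimately show ?thesis by blast
qed

end
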